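(* Let $(W,H,\mu)$ be an abstract Wiener space, let $V=I_W+v:W\to W$, with $v:W\to H$, be an absolutely continuous transformation of the Wiener measure, i.e. $V\mu\ll\mu$, and let $L\in L^1_+(\mu)$ be the Radon–Nikodym derivative of $V\mu$ with respect to $\mu$. Let $T=I_W+\nabla\phi$ be the transport map such that $T\mu=L\cdot\mu$, let $T^{-1}$ be its inverse, and write the rotation $s=T^{-1}\circ V$ (i.e. $s\mu=\mu$) as $s=I_W+\alpha$. Let $\mathcal R_2$ denote the subset of $L^2(\mu,H)$ whose elements $\eta$ are defined by the property that $x\mapsto x+\eta(x)$ is a rotation, i.e. it preserves the Wiener measure $\mu$. Then $\alpha$ is the unique element of $\mathcal R_2$ which minimizes the functional $$\eta\mapsto M_v(\eta)=E\left[\frac12|\eta|_H^2-(v,\eta)_H\right].$$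
   Context: Abstract Wiener space: $W$ is a separable Fréchet space, $H$ (the Cameron–Martin space) is a separable Hilbert space densely and continuously embedded in $W$, with $W^*\hookrightarrow H^*=H\hookrightarrow W$, and $\mu$ (the Wiener measure) is the probability on $\mathcal B(W)$ such that each $e\in W^*$ has law $N(0,|e|_H^2)$ under $\mu$. $E$ is expectation under $\mu$; $V\mu$ is the image of $\mu$ under $V$; $L\cdot\mu$ is the measure with density $L$ with respect to $\mu$. $\Sigma(\xi,\eta)$ is the set of probability measures on $W\times W$ with marginals $\xi$ and $\eta$, and $d_H^2(\xi,\eta)=\inf\{\int_{W\times W}|x-y|_H^2\,d\beta(x,y):\beta\in\Sigma(\xi,\eta)\}$, where $|x-y|_H=\infty$ if $x-y\notin H$; the Monge–Kantorovitch problem asks for a minimizing $\beta$. Transport map: if $\nu\ll\mu$ is a probability with $d_H(\mu,\nu)<\infty$, the Monge–Kantorovitch problem for $\Sigma(\mu,\nu)$ has a unique solution $\gamma$, and $\gamma=(I_W\times T)\mu$, where $T=I_W+\nabla\phi$ is the transport map of $\mu$ to $\nu$ (so $T\mu=\nu$), with $\phi\in\mathbb D_{2,1}$ (the Gaussian Sobolev space of $L^2(\mu)$ functions with Malliavin gradient $\nabla\phi\in L^2(\mu,H)$) 1-convex, i.e. $h\mapsto\phi(x+h)+\frac12|h|_H^2$ is convex on $H$ with values in $L^0(\mu)$; and there is $T^{-1}$ with $T^{-1}\nu=\mu$, $T^{-1}\circ T=I_W$ $\mu$-a.s. and $T\circ T^{-1}=I_W$ $\nu$-a.s. The map $T$ in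 the claim is the transport map for $\nu=V\mu=L\cdot\mu$.
   Formalization: The shift v is assumed to be in L²(μ,H); without this the claim fails (if V is a rotation with v not in L², then T = I and α = v is not in R₂), and α lies in L² exactly when v does. *)

theory Defs
  imports "HOL-Probability.Probability"
begin

text \<open>Frechet spaces. The metric of the type is taken to be a complete translation-invariant one;
  every Frechet space carries one, and the notions below depend on it only through
  its topology.\<close>

class frechet_space = real_vector + complete_space +
  assumes dist_translation: "dist (x + z) (y + z) = dist x y"
    and tendsto_scaleR_Pair: "filterlim (\<lambda>p. fst p *\<^sub>R snd p) (nhds (a *\<^sub>R x)) (nhds a \<times>\<^sub>F nhds x)"
    and locally_convex: "open U \<Longrightarrow> 0 \<in> U \<Longrightarrow>
      \<exists>C. open C \<and> 0 \<in> C \<and> C \<subseteq> U \<and>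
        (\<forall>x\<in>C. \<forall>y\<in>C. \<forall>t. 0 \<le> t \<and> t \<le> 1 \<longrightarrow> (1 - t) *\<^sub>R x + t *\<^sub>R y \<in> C)"

text \<open>The embedding of \<open>W\<^sup>*\<close> into \<open>H\<^sup>* = H\<close>: the continuous linear functional \<open>l\<close> on \<open>W\<close>
  is identified with the vector \<open>e\<close> of \<open>H\<close> representing its restriction to \<open>H\<close>.
  Here and below \<open>\<iota>\<close> is the inclusion of \<open>H\<close> into \<open>W\<close>.\<close>

definition dual_elem ::
    "('h::real_inner \<Rightarrow> 'w::{real_vector,topological_space}) \<Rightarrow> ('w \<Rightarrow> real) \<Rightarrow> 'h \<Rightarrow> bool" where
  "dual_elem \<iota> l e \<longleftrightarrow> linear l \<and> continuous_on UNIV l \<and> (\<forall>h. l (\<iota> h) = inner e h)"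

text \<open>The law \<open>N(0, \<sigma>\<^sup>2)\<close>, which is the Dirac mass at 0 when \<open>\<sigma> = 0\<close>.\<close>

definition centered_normal :: "real \<Rightarrow> real measure" where
  "centered_normal \<sigma> =
     (if \<sigma> = 0 then return borel 0 else density lborel (\<lambda>x. ennreal (normal_density 0 \<sigma> x)))"

text \<open>For the metrizable space \<open>W\<close> and the Hilbert space \<open>H\<close>, separability is expressed by the
  class \<open>second_countable_topology\<close>.\<close>

locale abstract_wiener_space = prob_space \<mu>
  for \<mu> :: "'w::{frechet_space, second_countable_topology} measure" +
  fixes \<iota> :: "'h::{real_inner, complete_space, second_countable_topology} \<Rightarrow> 'w"
  assumes sets_wiener: "sets \<mu> = sets borel"
    and linear_incl: "linear \<iota>"
    and continuous_incl: "continuous_on UNIV \<iota>"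
    and inj_incl: "inj \<iota>"
    and dense_incl: "closure (range \<iota>) = UNIV"
    and law_dual_elem: "dual_elem \<iota> l e \<Longrightarrow> distr \<mu> borel l = centered_normal (norm e)"

text \<open>\<open>L\<^sup>2(\<mu>)\<close> and \<open>L\<^sup>2(\<mu>,H)\<close>, through representatives.\<close>

definition L2 :: "'w measure \<Rightarrow> ('w \<Rightarrow> 'b::{real_normed_vector, second_countable_topology}) set" where
  "L2 \<mu> = {f \<in> borel_measurable \<mu>. integrable \<mu> (\<lambda>x. (norm (f x))\<^sup>2)}"


subsection \<open>The Monge--Kantorovitch problem\<close>

definition couplings ::
    "'w::{second_countable_topology} measure \<Rightarrow> 'w measure \<Rightarrow> ('w \<times> 'w) measure set" where
  "couplings \<xi> \<eta> =
     {\<beta>. prob_space \<beta> \<and> sets \<beta> = sets borel \<and> distr \<beta> borel fst = \<xi> \<and> distr \<beta> borel snd = \<eta>}"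

definition cm_norm :: "('h::real_inner \<Rightarrow> 'w) \<Rightarrow> 'w \<Rightarrow> ennreal" where
  "cm_norm \<iota> z = (if z \<in> range \<iota> then ennreal (norm (inv \<iota> z)) else \<infinity>)"

definition mk_cost ::
    "('h::real_inner \<Rightarrow> 'w::{real_vector, second_countable_topology}) \<Rightarrow> ('w \<times> 'w) measure \<Rightarrow> ennreal" where
  "mk_cost \<iota> \<beta> = (\<integral>\<^sup>+ z. (cm_norm \<iota> (fst z - snd z))\<^sup>2 \<partial>\<beta>)"

definition dH_sq ::
    "('h::real_inner \<Rightarrow> 'w::{real_vector, second_countable_topology}) \<Rightarrow> 'w measure \<Rightarrow> 'w measure \<Rightarrow> ennreal" where
  "dH_sq \<iota> \<xi> \<eta> = (INF \<beta> \<in> couplings \<xi> \<eta>. mk_cost \<iota> \<beta>)"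

definition mk_solutions ::
    "('h::real_inner \<Rightarrow> 'w::{real_vector, second_countable_topology}) \<Rightarrow> 'w measure \<Rightarrow> 'w measure
      \<Rightarrow> ('w \<times> 'w) measure set" where
  "mk_solutions \<iota> \<xi> \<eta> = {\<beta> \<in> couplings \<xi> \<eta>. mk_cost \<iota> \<beta> = dH_sq \<iota> \<xi> \<eta>}"


subsection \<open>Gaussian Sobolev space\<close>

text \<open>\<open>f\<close> is a smooth function on \<open>\<real>\<^sup>n\<close>, bounded with all its derivatives, and \<open>df i\<close> (\<open>i < n\<close>) are its
  first partial derivatives. Points of \<open>\<real>\<^sup>n\<close> are sequences of which only the coordinates below
  \<open>n\<close> matter; \<open>D [i\<^sub>1, \<dots>, i\<^sub>k]\<close> is the iterated partial derivative in the directions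
  \<open>i\<^sub>1, \<dots>, i\<^sub>k\<close>.\<close>

definition smooth_bounded ::
    "nat \<Rightarrow> ((nat \<Rightarrow> real) \<Rightarrow> real) \<Rightarrow> (nat \<Rightarrow> (nat \<Rightarrow> real) \<Rightarrow> real) \<Rightarrow> bool" where
  "smooth_bounded n f df \<longleftrightarrow>
     (\<exists>D :: nat list \<Rightarrow> (nat \<Rightarrow> real) \<Rightarrow> real.
        D [] = f \<and> (\<forall>i<n. D [i] = df i) \<and>
        (\<forall>js. set js \<subseteq> {..<n} \<longrightarrow>
           (\<forall>x y. (\<forall>i<n. x i = y i) \<longrightarrow> D js x = D js y) \<and>
           continuous_on UNIV (D js) \<and> bounded (range (D js)) \<and>
           (\<forall>i<n. \<forall>x. ((\<lambda>t. D js (x(i := t))) has_real_derivative D (i # js) x) (at (x i)))))"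

text \<open>\<open>F\<close> is a smooth cylindrical function with gradient \<open>F'\<close>:
  \<open>F = f(l\<^sub>0, \<dots>, l\<^bsub>n-1\<^esub>)\<close> with \<open>l\<^sub>i \<in> W\<^sup>*\<close>, and \<open>F' = \<Sum>\<^sub>i df i (l\<^sub>0, \<dots>, l\<^bsub>n-1\<^esub>) l\<^sub>i\<close>.\<close>

definition cylindrical ::
    "('h::real_inner \<Rightarrow> 'w::{real_vector,topological_space}) \<Rightarrow> ('w \<Rightarrow> real) \<Rightarrow> ('w \<Rightarrow> 'h) \<Rightarrow> bool" where
  "cylindrical \<iota> F F' \<longleftrightarrow>
     (\<exists>n f df l e. smooth_bounded n f df \<and> (\<forall>i<n. dual_elem \<iota> (l i) (e i)) \<and>
        F = (\<lambda>w. f (\<lambda>i. l i w)) \<and>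
        F' = (\<lambda>w. \<Sum>i<n. df i (\<lambda>j. l j w) *\<^sub>R e i))"

text \<open>\<open>\<phi>\<close> belongs to \<open>\<bbbD>\<^bsub>2,1\<^esub>\<close> and \<open>\<nabla>\<phi> = G\<close>: the pair lies in the \<open>L\<^sup>2\<close>-closure of the graph of the
  gradient on smooth cylindrical functions.\<close>

definition sobolev_gradient ::
    "'w::{real_vector, topological_space} measure \<Rightarrow> ('h::{real_inner, second_countable_topology} \<Rightarrow> 'w)
      \<Rightarrow> ('w \<Rightarrow> real) \<Rightarrow> ('w \<Rightarrow> 'h) \<Rightarrow> bool" where
  "sobolev_gradient \<mu> \<iota> \<phi> G \<longleftrightarrow> \<phi> \<in> L2 \<mu> \<and> G \<in> L2 \<mu> \<and>
     (\<exists>F F'. (\<forall>k::nat. cylindrical \<iota> (F k) (F' k)) \<and>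
        (\<lambda>k. \<integral>\<^sup>+ x. ennreal ((F k x - \<phi> x)\<^sup>2) \<partial>\<mu>) \<longlonglongrightarrow> 0 \<and>
        (\<lambda>k. \<integral>\<^sup>+ x. ennreal ((norm (F' k x - G x))\<^sup>2) \<partial>\<mu>) \<longlonglongrightarrow> 0)"

text \<open>Convexity of \<open>h \<mapsto> \<phi>(\<sqdot> + h) + |h|\<^sup>2 / 2\<close> as a map into \<open>L\<^sup>0(\<mu>)\<close>: the exceptional null set may
  depend on \<open>h\<close>, \<open>k\<close> and \<open>t\<close>.\<close>

definition one_convex ::
    "'w::real_vector measure \<Rightarrow> ('h::real_inner \<Rightarrow> 'w) \<Rightarrow> ('w \<Rightarrow> real) \<Rightarrow> bool" where
  "one_convex \<mu> \<iota> \<phi> \<longleftrightarrow>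
     (\<forall>h k. \<forall>t\<in>{0..1}. AE x in \<mu>.
        \<phi> (x + \<iota> ((1 - t) *\<^sub>R h + t *\<^sub>R k)) + (norm ((1 - t) *\<^sub>R h + t *\<^sub>R k))\<^sup>2 / 2
          \<le> (1 - t) * (\<phi> (x + \<iota> h) + (norm h)\<^sup>2 / 2) + t * (\<phi> (x + \<iota> k) + (norm k)\<^sup>2 / 2))"


subsection \<open>Transport maps and rotations\<close>

text \<open>\<open>T = I\<^sub>W + \<nabla>\<phi>\<close> is the transport map of \<open>\<mu>\<close> to \<open>\<nu>\<close>: the unique solution of the
  Monge--Kantorovitch problem for \<open>(\<mu>, \<nu>)\<close> is carried by the graph of \<open>T\<close>.\<close>

definition transport_map ::
    "'w::{frechet_space, second_countable_topology} measure
      \<Rightarrow> ('h::{real_inner, second_countable_topology} \<Rightarrow> 'w)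
      \<Rightarrow> 'w measure \<Rightarrow> ('w \<Rightarrow> real) \<Rightarrow> ('w \<Rightarrow> 'w) \<Rightarrow> bool" where
  "transport_map \<mu> \<iota> \<nu> \<phi> T \<longleftrightarrow>
     T \<in> borel_measurable borel \<and> distr \<mu> borel T = \<nu> \<and>
     mk_solutions \<iota> \<mu> \<nu> = {distr \<mu> borel (\<lambda>x. (x, T x))} \<and>
     one_convex \<mu> \<iota> \<phi> \<and>
     (\<exists>G. sobolev_gradient \<mu> \<iota> \<phi> G \<and> (AE x in \<mu>. T x = x + \<iota> (G x)))"

definition transport_inverse ::
    "'w::topological_space measure \<Rightarrow> 'w measure \<Rightarrow> ('w \<Rightarrow> 'w) \<Rightarrow> ('w \<Rightarrow> 'w) \<Rightarrow> bool" where
  "transport_inverse \<mu> \<nu> T S \<longleftrightarrow>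
     S \<in> borel_measurable borel \<and> distr \<nu> borel S = \<mu> \<and>
     (AE x in \<mu>. S (T x) = x) \<and> (AE y in \<nu>. T (S y) = y)"

definition R2 ::
    "'w::{real_vector, topological_space} measure
      \<Rightarrow> ('h::{real_inner, second_countable_topology} \<Rightarrow> 'w) \<Rightarrow> ('w \<Rightarrow> 'h) set" where
  "R2 \<mu> \<iota> = {\<eta> \<in> L2 \<mu>. distr \<mu> borel (\<lambda>x. x + \<iota> (\<eta> x)) = \<mu>}"

definition M_functional ::
    "'w measure \<Rightarrow> ('w \<Rightarrow> 'h::real_inner) \<Rightarrow> ('w \<Rightarrow> 'h) \<Rightarrow> real" where
  "M_functional \<mu> v \<eta> = (\<integral>x. (1/2) * (norm (\<eta> x))\<^sup>2 - inner (v x) (\<eta> x) \<partial>\<mu>)"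

end

theory Submission
  imports Defs
begin

text \<open>For \<open>\<eta> \<in> R2\<close> the law of \<open>(x + \<eta>(x), V x)\<close> is a coupling of \<open>\<mu>\<close> and \<open>V\<mu>\<close>
  of cost \<open>E|\<eta> - v|\<^sup>2 = 2 M\<^sub>v(\<eta>) + E|v|\<^sup>2\<close>, so minimizing \<open>M\<^sub>v\<close> over rotations is a
  Monge--Kantorovitch problem. Since \<open>V = T \<circ> s\<close> almost surely and \<open>s\<close> is a rotation, the law of
  \<open>(s, V)\<close> is that of \<open>(x, T x)\<close>, the unique optimal coupling; so \<open>\<alpha>\<close> is a minimizer. Conversely
  a minimizer \<open>\<eta>\<close> yields an optimal coupling, which is carried by the graph of \<open>T\<close>; then
  \<open>V x = T (x + \<eta>(x))\<close> almost surely, and applying \<open>T\<^sup>-\<^sup>1\<close> gives \<open>s x = x + \<eta>(x)\<close>.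

  Computing the cost of a coupling requires the Cameron--Martin norm to be Borel on \<open>W\<close>; it is
  lower semicontinuous, because balls of \<open>H\<close> are closed in \<open>W\<close>.\<close>

section \<open>Continuity of the group operations of a Frechet space\<close>

text \<open>Translation invariance makes negation an isometry and bounds
  \<open>dist (x + y) (a + b)\<close> by \<open>dist x a + dist y b\<close>. The instance supplies
  the continuity rules for sums and differences in W.\<close>

instance frechet_space \<subseteq> topological_group_add
proof
  fix a b :: 'a
  have *: "dist (x + y) (a + b) \<le> dist x a + dist y b" for x y :: 'a
  proof -
    have "dist (x + y) (a + b) \<le> dist (x + y) (a + y) + dist (a + y) (a + b)"
      by (rule dist_triangle)
    then show ?thesis
      using dist_translation[of x y a] dist_translation[of y a b] by (simp add: add.commute)
  qed
  have "((\<lambda>p. dist (fst p) a + dist (snd p) b) \<longlongrightarrow> dist a a + dist b b) (nhds a \<times>\<^sub>F nhds b)"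
    by (intro tendsto_intros filterlim_fst filterlim_snd)
  then have "((\<lambda>p. dist (fst p) a + dist (snd p) b) \<longlongrightarrow> 0) (nhds a \<times>\<^sub>F nhds b)"
    by simp
  then show "((\<lambda>p. fst p + snd p) \<longlongrightarrow> a + b) (nhds a \<times>\<^sub>F nhds b)"
    unfolding tendsto_dist_iff[of "\<lambda>p. fst p + snd p"]
    by (rule Lim_null_comparison[rotated]) (simp add: *)
next
  fix a :: 'a
  have *: "dist (- x) (- a) = dist x a" for x :: 'a
    using dist_translation[of "- x" "x + a" "- a"] by (simp add: dist_commute)
  have "((\<lambda>x. dist x a) \<longlongrightarrow> dist a a) (nhds a)"
    by (intro tendsto_intros filterlim_ident)
  then show "(uminus \<longlongrightarrow> - a) (nhds a)"
    unfolding tendsto_dist_iff[of uminus] by (simp add: *)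
qed

section \<open>Borel measurability of the Cameron-Martin norm\<close>

text \<open>Points of almost minimal norm do the job: their squared norms approach the limit of an
  increasing bounded sequence, and the parallelogram law turns this into the Cauchy property. This
  stands in for weak compactness of balls.\<close>

lemma decseq_convex_Cauchy_selection:
  fixes C :: "nat \<Rightarrow> 'h::real_inner set"
  assumes ne: "\<And>n. C n \<noteq> {}" and conv: "\<And>n. convex (C n)" and dec: "decseq C"
    and bdd: "bounded (C 0)"
  shows "\<exists>g. (\<forall>n. g n \<in> C n) \<and> Cauchy g"
proof -
  define d where "d n = (INF x\<in>C n. (norm x)\<^sup>2)" for n
  obtain B where B: "\<And>x. x \<in> C 0 \<Longrightarrow> norm x \<le> B"
    using bdd by (auto simp: bounded_iff)
  have sub: "C m \<subseteq> C n" if "n \<le> m" for m n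
    using dec that by (auto simp: decseq_def)
  have bdd_below: "bdd_below ((\<lambda>x. (norm x)\<^sup>2) ` C n)" for n
    by (rule bdd_belowI[where m = 0]) auto
  have d_le: "d n \<le> (norm x)\<^sup>2" if "x \<in> C n" for n x
    unfolding d_def by (rule cINF_lower[OF bdd_below that])
  have "\<exists>x\<in>C n. (norm x)\<^sup>2 < d n + 1 / Suc n" for n
  proof -
    have "d n < d n + 1 / Suc n" by simp
    then show ?thesis
      unfolding d_def by (subst (asm) cINF_less_iff[OF ne bdd_below]) blast
  qed
  then obtain g where g: "\<And>n. g n \<in> C n" "\<And>n. (norm (g n))\<^sup>2 < d n + 1 / Suc n"
    by metis
  have "incseq d"
    unfolding d_def incseq_def by (auto intro!: cINF_superset_mono ne bdd_below sub)
  moreover have "d n \<le> B\<^sup>2" for n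
  proof -
    have "norm (g n) \<le> B" using g(1)[of n] sub[of 0 n] B by auto
    then have "(norm (g n))\<^sup>2 \<le> B\<^sup>2" by (intro power_mono) auto
    then show ?thesis using d_le[OF g(1)] by (rule order_trans[rotated])
  qed
  ultimately obtain D where D: "d \<longlonglongrightarrow> D" "\<And>n. d n \<le> D"
    using incseq_convergent[of d "B\<^sup>2"] by blast
  \<comment> \<open>The midpoint of \<open>g n\<close> and \<open>g m\<close> lies in
    \<open>C n\<close>, so its squared norm is at least \<open>d n\<close>. The slacks
    \<open>1 / Suc n\<close> and \<open>1 / Suc m\<close>, each doubled by the parallelogram law,
    give \<open>4 / Suc n\<close>.\<close>
  have *: "(norm (g n - g m))\<^sup>2 \<le> 2 * (D - d n) + 4 / Suc n" if "n \<le> m" for m n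
  proof -
    have "g m \<in> C n" using g(1)[of m] sub[OF that] by auto
    then have "(1/2) *\<^sub>R g n + (1/2) *\<^sub>R g m \<in> C n"
      using g(1)[of n] conv[of n] by (intro convexD) auto
    then have "d n \<le> (norm ((1/2) *\<^sub>R g n + (1/2) *\<^sub>R g m))\<^sup>2" by (rule d_le)
    moreover have "(norm (g n - g m))\<^sup>2 =
        2 * (norm (g n))\<^sup>2 + 2 * (norm (g m))\<^sup>2 - 4 * (norm ((1/2) *\<^sub>R g n + (1/2) *\<^sub>R g m))\<^sup>2"
      by (simp add: power2_norm_eq_inner inner_simps inner_commute algebra_simps)
    moreover have "1 / real (Suc m) \<le> 1 / real (Suc n)"
      using that by (intro divide_left_mono) auto
    ultimately show ?thesis using g(2)[of n] g(2)[of m] D(2)[of m] by simp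
  qed
  have "Cauchy g"
  proof (rule metric_CauchyI)
    fix e :: real assume "e > 0"
    have "(\<lambda>n. 2 * (D - d n) + 4 * (1 / real (Suc n))) \<longlonglongrightarrow> 2 * (D - D) + 4 * 0"
      by (intro tendsto_intros D(1) LIMSEQ_Suc[OF lim_1_over_n])
    then have "(\<lambda>n. 2 * (D - d n) + 4 / Suc n) \<longlonglongrightarrow> 0" by simp
    then have "\<forall>\<^sub>F n in sequentially. 2 * (D - d n) + 4 / Suc n < (e/2)\<^sup>2"
      using \<open>e > 0\<close> by (intro order_tendstoD) auto
    then obtain N where N: "2 * (D - d N) + 4 / Suc N < (e/2)\<^sup>2"
      using eventually_happens'[OF sequentially_bot] by blast
    have close: "dist (g N) (g m) < e/2" if "N \<le> m" for m
    proof -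
      have "(norm (g N - g m))\<^sup>2 < (e/2)\<^sup>2" using *[OF that] N by (rule le_less_trans)
      then show ?thesis
        unfolding dist_norm by (rule power_less_imp_less_base) (use \<open>e > 0\<close> in simp)
    qed
    show "\<exists>N. \<forall>m\<ge>N. \<forall>n\<ge>N. dist (g m) (g n) < e"
      using close dist_triangle_half_r by blast
  qed
  with g(1) show ?thesis by blast
qed

text \<open>For \<open>w\<close> in the closure, the vectors of the ball sent close to
  \<open>w\<close> form decreasing convex sets. A Cauchy selection from them converges in H, and
  continuity of the inclusion sends its limit to \<open>w\<close>.\<close>

lemma closed_image_cball:
  fixes \<iota> :: "'h::{real_inner, complete_space} \<Rightarrow> 'w::frechet_space"
  assumes lin: "linear \<iota>" and cont: "continuous_on UNIV \<iota>"
  shows "closed (\<iota> ` cball 0 r)"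
proof -
  have "w \<in> \<iota> ` cball 0 r" if w: "w \<in> closure (\<iota> ` cball 0 r)" for w
  proof -
    \<comment> \<open>Metric balls of W may fail to be convex; local convexity shrinks them to
      convex neighbourhoods.\<close>
    have "\<exists>U::'w set. open U \<and> 0 \<in> U \<and> U \<subseteq> ball 0 (1 / Suc n) \<and> convex U" for n
    proof -
      have "(0::'w) \<in> ball 0 (1 / Suc n)" by simp
      from locally_convex[OF open_ball this] obtain K :: "'w set"
        where "open K" "0 \<in> K" "K \<subseteq> ball 0 (1 / Suc n)"
          "\<forall>x\<in>K. \<forall>y\<in>K. \<forall>t. 0 \<le> t \<and> t \<le> 1 \<longrightarrow> (1 - t) *\<^sub>R x + t *\<^sub>R y \<in> K"
        by blast
      then show ?thesis unfolding convex_alt by blast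
    qed
    then obtain U :: "nat \<Rightarrow> 'w set" where U: "\<And>n. open (U n)" "\<And>n. 0 \<in> U n"
        "\<And>n. U n \<subseteq> ball 0 (1 / Suc n)" "\<And>n. convex (U n)"
      by metis
    \<comment> \<open>The \<open>U k\<close> need not be nested; imposing all
      \<open>k \<le> n\<close> makes \<open>C\<close> decreasing.\<close>
    define C where "C n = {h \<in> cball 0 r. \<forall>k\<le>n. \<iota> h - w \<in> U k}" for n
    have "C n \<noteq> {}" for n
    proof -
      have "open (\<Inter>k\<le>n. (\<lambda>y. y - w) -` U k)"
        by (intro open_INT ballI open_vimage U continuous_intros) auto
      moreover have "w \<in> (\<Inter>k\<le>n. (\<lambda>y. y - w) -` U k)" using U(2) by simp
      ultimately have "(\<Inter>k\<le>n. (\<lambda>y. y - w) -` U k) \<inter> \<iota> ` cball 0 r \<noteq> {}"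
        using w open_Int_closure_eq_empty by blast
      then show ?thesis unfolding C_def by auto
    qed
    moreover have "convex (C n)" for n
    proof -
      have "\<iota> (a *\<^sub>R x + b *\<^sub>R y) - w = a *\<^sub>R (\<iota> x - w) + b *\<^sub>R (\<iota> y - w)" if "a + b = 1" for a b x y
        using that by (simp add: linear_add[OF lin] linear_scale[OF lin] algebra_simps
            flip: scaleR_add_left)
      then show ?thesis
        using convex_cball[of "0::'h" r] U(4) unfolding convex_def C_def by simp
    qed
    moreover have "decseq C" by (auto simp: decseq_def C_def)
    moreover have "bounded (C 0)"
      by (rule bounded_subset[OF bounded_cball[of 0 r]]) (auto simp: C_def)
    ultimately obtain g where g: "\<And>n. g n \<in> C n" "Cauchy g"
      using decseq_convex_Cauchy_selection[of C] by blast
    then obtain h where h: "g \<longlonglongrightarrow> h"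
      using Cauchy_convergent[OF g(2)] unfolding convergent_def by blast
    have "g n \<in> cball 0 r" for n using g(1)[of n] by (simp add: C_def)
    then have "h \<in> cball 0 r"
      by (rule closed_sequentially[OF closed_cball _ h])
    moreover have "(\<lambda>n. \<iota> (g n)) \<longlonglongrightarrow> \<iota> h"
      using continuous_on_tendsto_compose[OF cont h] by simp
    moreover have "(\<lambda>n. \<iota> (g n)) \<longlonglongrightarrow> w"
    proof (rule metric_tendsto_imp_tendsto[OF LIMSEQ_Suc[OF lim_1_over_n]], rule always_eventually, rule allI)
      fix n
      have "\<iota> (g n) - w \<in> ball 0 (1 / Suc n)" using g(1)[of n] U(3)[of n] by (auto simp: C_def)
      then show "dist (\<iota> (g n)) w \<le> dist (1 / real (Suc n)) 0"
        using dist_translation[of "\<iota> (g n) - w" w 0] by (simp add: dist_commute)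
    qed
    ultimately show ?thesis using LIMSEQ_unique by blast
  qed
  then show ?thesis
    using closure_subset closed_closure by (metis subsetI subset_antisym)
qed

text \<open>Sublevel sets at finite levels are images of closed balls of H, hence closed.\<close>

lemma borel_measurable_cm_norm:
  fixes \<iota> :: "'h::{real_inner, complete_space} \<Rightarrow> 'w::frechet_space"
  assumes lin: "linear \<iota>" and cont: "continuous_on UNIV \<iota>" and inj: "inj \<iota>"
  shows "cm_norm \<iota> \<in> borel_measurable borel"
proof (rule borel_measurableI_le)
  fix y :: ennreal
  show "{z \<in> space borel. cm_norm \<iota> z \<le> y} \<in> sets borel"
  proof (cases y)
    case (real r)
    then have "{z \<in> space borel. cm_norm \<iota> z \<le> y} = \<iota> ` cball 0 r"
      by (auto simp: cm_norm_def inj inj_eq[OF inj] top_unique split: if_splits)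
    then show ?thesis using closed_image_cball[OF lin cont] by simp
  qed simp
qed

section \<open>Square-integrable fields and the functional\<close>

lemma L2_diff:
  fixes f g :: "'a \<Rightarrow> 'h::{real_inner, second_countable_topology}"
  assumes f: "f \<in> L2 M" and g: "g \<in> L2 M"
  shows "(\<lambda>x. f x - g x) \<in> L2 M"
proof -
  have [measurable]: "f \<in> borel_measurable M" "g \<in> borel_measurable M"
    using f g by (auto simp: L2_def)
  have le: "(norm (a - b))\<^sup>2 \<le> 2 * (norm a)\<^sup>2 + 2 * (norm b)\<^sup>2" for a b :: 'h
  proof -
    have "0 \<le> (norm (a + b))\<^sup>2" by simp
    then show ?thesis
      unfolding power2_norm_eq_inner by (simp add: inner_simps inner_commute)
  qed
  have "integrable M (\<lambda>x. (norm (f x - g x))\<^sup>2)"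
  proof (rule Bochner_Integration.integrable_bound)
    show "integrable M (\<lambda>x. 2 * (norm (f x))\<^sup>2 + 2 * (norm (g x))\<^sup>2)"
      using f g by (auto simp: L2_def)
  qed (auto simp: le)
  then show ?thesis by (simp add: L2_def)
qed

lemma L2_cong_AE:
  assumes "f \<in> L2 M" "g \<in> borel_measurable M" "AE x in M. f x = g x"
  shows "g \<in> L2 M"
proof -
  have "integrable M (\<lambda>x. (norm (g x))\<^sup>2)"
    using assms
    by (subst integrable_cong_AE[where g = "\<lambda>x. (norm (f x))\<^sup>2"])
      (auto simp: L2_def elim: eventually_mono)
  then show ?thesis using assms by (simp add: L2_def)
qed

text \<open>Completing the square: the term in \<open>v\<close> alone is constant, so minimizing
  over \<open>\<eta>\<close> amounts to minimizing the mean squared distance to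
  \<open>v\<close>.\<close>

lemma M_functional_eq:
  fixes v \<eta> :: "'w \<Rightarrow> 'h::{real_inner, second_countable_topology}"
  assumes v: "v \<in> L2 \<mu>" and \<eta>: "\<eta> \<in> L2 \<mu>"
  shows "M_functional \<mu> v \<eta> =
    (\<integral>x. (norm (\<eta> x - v x))\<^sup>2 \<partial>\<mu>) / 2 - (\<integral>x. (norm (v x))\<^sup>2 \<partial>\<mu>) / 2"
proof -
  have "(1/2) * (norm (\<eta> x))\<^sup>2 - inner (v x) (\<eta> x) =
      (norm (\<eta> x - v x))\<^sup>2 / 2 - (norm (v x))\<^sup>2 / 2" for x
    by (simp add: power2_norm_eq_inner inner_simps inner_commute field_simps)
  then show ?thesis
    using L2_diff[OF \<eta> v] v unfolding M_functional_def by (simp add: L2_def)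
qed

section \<open>Couplings given by pairs of maps\<close>

lemma distr_Pair_couplings:
  assumes "prob_space M" "f \<in> borel_measurable M" "g \<in> borel_measurable M"
  shows "distr M borel (\<lambda>x. (f x, g x)) \<in> couplings (distr M borel f) (distr M borel g)"
proof -
  have [measurable]: "f \<in> borel_measurable M" "g \<in> borel_measurable M" using assms by auto
  have [measurable]: "fst \<in> borel_measurable borel" "snd \<in> borel_measurable borel"
    by (intro borel_measurable_continuous_onI continuous_intros)+
  show ?thesis
    using assms(1) by (simp add: couplings_def distr_distr comp_def prob_space.prob_space_distr)
qed

lemma mk_cost_distr:
  fixes \<iota> :: "'h::{real_inner, complete_space, second_countable_topology}
      \<Rightarrow> 'w::{frechet_space, second_countable_topology}"
  assumes lin: "linear \<iota>" and cont: "continuous_on UNIV \<iota>" and inj: "inj \<iota>"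
    and f: "f \<in> borel_measurable M" and g: "g \<in> borel_measurable M"
    and h: "h \<in> L2 M" and eq: "\<And>x. f x - g x = \<iota> (h x)"
  shows "mk_cost \<iota> (distr M borel (\<lambda>x. (f x, g x))) = ennreal (\<integral>x. (norm (h x))\<^sup>2 \<partial>M)"
proof -
  note [measurable] = f g borel_measurable_cm_norm[OF lin cont inj]
  have [measurable]: "(\<lambda>z::'w \<times> 'w. fst z - snd z) \<in> borel_measurable borel"
    by (intro borel_measurable_continuous_onI continuous_intros)
  have "mk_cost \<iota> (distr M borel (\<lambda>x. (f x, g x))) = (\<integral>\<^sup>+ x. (cm_norm \<iota> (f x - g x))\<^sup>2 \<partial>M)"
    unfolding mk_cost_def by (subst nn_integral_distr) auto
  also have "\<dots> = (\<integral>\<^sup>+ x. ennreal ((norm (h x))\<^sup>2) \<partial>M)"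
    by (simp add: eq cm_norm_def inj ennreal_power)
  also have "\<dots> = ennreal (\<integral>x. (norm (h x))\<^sup>2 \<partial>M)"
    using h by (intro nn_integral_eq_integral) (auto simp: L2_def)
  finally show ?thesis .
qed

text \<open>The graph of \<open>T\<close> is the zero set of a Borel function and carries the law of
  \<open>(x, T x)\<close>. This turns uniqueness of the optimal coupling into an almost sure
  identity.\<close>

lemma AE_eq_graph:
  fixes f g :: "'a \<Rightarrow> 'b::{second_countable_topology, metric_space}"
  assumes f: "f \<in> borel_measurable M" and g: "g \<in> borel_measurable M"
    and T: "T \<in> borel_measurable borel"
    and sets: "sets N = sets borel"
    and eq: "distr M borel (\<lambda>x. (f x, g x)) = distr N borel (\<lambda>x. (x, T x))"
  shows "AE x in M. g x = T (f x)"
proof -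
  note [measurable] = f g T
  have [measurable]: "fst \<in> borel_measurable (borel :: ('b \<times> 'b) measure)"
      "snd \<in> borel_measurable (borel :: ('b \<times> 'b) measure)"
    by (intro borel_measurable_continuous_onI continuous_intros)+
  have [measurable]: "(\<lambda>x. x) \<in> borel_measurable N" "T \<in> borel_measurable N"
    using sets measurable_cong_sets T by auto
  have "{z. dist (snd z) (T (fst z)) = 0} \<in> sets (borel :: ('b \<times> 'b) measure)"
    by measurable
  then have "AE z in distr N borel (\<lambda>x. (x, T x)). dist (snd z) (T (fst z)) = 0"
    by (subst AE_distr_iff) auto
  then have "AE z in distr M borel (\<lambda>x. (f x, g x)). snd z = T (fst z)"
    unfolding eq by simp
  then show ?thesis by (auto dest!: AE_distrD[rotated])
qed

section \<open>Minimization over rotations\<close>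

theorem proposition6p6:
  fixes \<mu> :: "'w::{frechet_space, second_countable_topology} measure"
    and \<iota> :: "'h::{real_inner, complete_space, second_countable_topology} \<Rightarrow> 'w"
    and v :: "'w \<Rightarrow> 'h" and V T Tinv s :: "'w \<Rightarrow> 'w"
    and L \<phi> :: "'w \<Rightarrow> real"
  assumes "abstract_wiener_space \<mu> \<iota>"
    and "v \<in> L2 \<mu>"
    and "V = (\<lambda>x. x + \<iota> (v x))"
    and "absolutely_continuous \<mu> (distr \<mu> borel V)"
    and "integrable \<mu> L" and "AE x in \<mu>. 0 \<le> L x"
    and "distr \<mu> borel V = density \<mu> (\<lambda>x. ennreal (L x))"
    and "transport_map \<mu> \<iota> (density \<mu> (\<lambda>x. ennreal (L x))) \<phi> T"
    and "transport_inverse \<mu> (density \<mu> (\<lambda>x. ennreal (L x))) T Tinv"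
    and "s = Tinv \<circ> V"
  shows "(\<exists>\<alpha> \<in> borel_measurable \<mu>. AE x in \<mu>. s x = x + \<iota> (\<alpha> x)) \<and>
         (\<forall>\<alpha> \<in> borel_measurable \<mu>. (AE x in \<mu>. s x = x + \<iota> (\<alpha> x)) \<longrightarrow>
           \<alpha> \<in> R2 \<mu> \<iota> \<and>
           (\<forall>\<eta> \<in> R2 \<mu> \<iota>. M_functional \<mu> v \<alpha> \<le> M_functional \<mu> v \<eta>) \<and>
           (\<forall>\<eta> \<in> R2 \<mu> \<iota>. (\<forall>\<zeta> \<in> R2 \<mu> \<iota>. M_functional \<mu> v \<eta> \<le> M_functional \<mu> v \<zeta>) \<longrightarrow>
              (AE x in \<mu>. \<eta> x = \<alpha> x)))"
proof -
  interpret abstract_wiener_space \<mu> \<iota> by fact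
  define \<nu> where "\<nu> = density \<mu> (\<lambda>x. ennreal (L x))"
  have \<nu>: "distr \<mu> borel V = \<nu>" using assms by (simp add: \<nu>_def)
  have [simp]: "sets \<mu> = sets borel" "space \<mu> = UNIV"
    using sets_wiener sets_eq_imp_space_eq[OF sets_wiener] by auto
  have meas: "borel_measurable \<mu> = (borel_measurable borel :: ('w \<Rightarrow> 'c::topological_space) set)"
    by (rule measurable_cong_sets) auto
  have [measurable]: "\<iota> \<in> borel_measurable borel"
    using continuous_incl by (rule borel_measurable_continuous_onI)
  have incl_diff: "\<iota> (a - b) = \<iota> a - \<iota> b" for a b by (rule linear_diff[OF linear_incl])
  have v_meas[measurable]: "v \<in> borel_measurable borel" using assms(2) by (simp add: L2_def meas)
  have V_meas[measurable]: "V \<in> borel_measurable borel" unfolding assms(3) by measurable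
  have trans: "transport_map \<mu> \<iota> \<nu> \<phi> T" "transport_inverse \<mu> \<nu> T Tinv"
    using assms by (simp_all add: \<nu>_def)
  then have T_meas[measurable]: "T \<in> borel_measurable borel"
      and Tinv_meas[measurable]: "Tinv \<in> borel_measurable borel"
      and sol: "mk_solutions \<iota> \<mu> \<nu> = {distr \<mu> borel (\<lambda>x. (x, T x))}"
    by (auto simp: transport_map_def transport_inverse_def)
  obtain G where G: "G \<in> L2 \<mu>" "AE x in \<mu>. T x = x + \<iota> (G x)"
    using trans(1) by (auto simp: transport_map_def sobolev_gradient_def)
  then have [measurable]: "G \<in> borel_measurable borel" by (simp add: L2_def meas)
  have s_meas[measurable]: "s \<in> borel_measurable borel"
    unfolding assms(10) by measurable
  have "distr \<mu> borel s = distr (distr \<mu> borel V) borel Tinv"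
    unfolding assms(10) by (subst distr_distr) (auto simp: meas)
  then have s_rot: "distr \<mu> borel s = \<mu>"
    using trans(2) \<nu> by (simp add: transport_inverse_def)
  have "AE y in distr \<mu> borel V. T (Tinv y) = y"
    unfolding \<nu> using trans(2) by (simp add: transport_inverse_def)
  then have V_eq: "AE x in \<mu>. V x = T (s x)"
    using assms(10) V_meas by (auto dest!: AE_distrD[rotated] simp: meas)

  \<comment> \<open>Almost surely \<open>V = T \<circ> s\<close>, that is,
    \<open>x + \<iota> (v x) = s x + \<iota> (G (s x))\<close>; solving for \<open>s x - x\<close>
    gives this measurable H-valued field.\<close>
  define \<alpha>0 where "\<alpha>0 = (\<lambda>x. v x - G (s x))"
  have [measurable]: "\<alpha>0 \<in> borel_measurable borel" unfolding \<alpha>0_def by measurable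
  have "AE x in distr \<mu> borel s. T x = x + \<iota> (G x)" unfolding s_rot by (rule G(2))
  then have "AE x in \<mu>. T (s x) = s x + \<iota> (G (s x))"
    using s_meas by (auto dest!: AE_distrD[rotated] simp: meas)
  with V_eq have s_eq: "AE x in \<mu>. s x = x + \<iota> (\<alpha>0 x)"
    unfolding assms(3) \<alpha>0_def incl_diff by eventually_elim (simp add: algebra_simps)
  \<comment> \<open>As \<open>s\<close> preserves \<open>\<mu>\<close>, composing \<open>G\<close>
    with \<open>s\<close> keeps its \<open>L2\<close> norm.\<close>
  have "integrable (distr \<mu> borel s) (\<lambda>x. (norm (G x))\<^sup>2)"
    using G(1) s_rot by (simp add: L2_def)
  then have "(\<lambda>x. G (s x)) \<in> L2 \<mu>"
    by (subst (asm) integrable_distr_eq) (auto simp: L2_def meas)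
  then have \<alpha>0_L2: "\<alpha>0 \<in> L2 \<mu>"
    unfolding \<alpha>0_def by (rule L2_diff[OF assms(2)])

  \<comment> \<open>Each \<open>\<eta>\<close> in \<open>R2\<close> yields the coupling
    \<open>\<beta> \<eta>\<close> of \<open>\<mu>\<close> and \<open>\<nu>\<close>, whose transport
    cost is \<open>Q \<eta>\<close>.\<close>
  define U where "U = (\<lambda>\<eta> x. x + \<iota> (\<eta> x))"
  define \<beta> where "\<beta> = (\<lambda>\<eta>. distr \<mu> borel (\<lambda>x. (U \<eta> x, V x)))"
  define Q where "Q = (\<lambda>\<eta>. \<integral>x. (norm (\<eta> x - v x))\<^sup>2 \<partial>\<mu>)"
  have U_meas: "U \<eta> \<in> borel_measurable borel" if "\<eta> \<in> R2 \<mu> \<iota>" for \<eta>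
  proof -
    have [measurable]: "\<eta> \<in> borel_measurable borel" using that by (simp add: R2_def L2_def meas)
    show ?thesis unfolding U_def by measurable
  qed
  have coupling: "\<beta> \<eta> \<in> couplings \<mu> \<nu>" if "\<eta> \<in> R2 \<mu> \<iota>" for \<eta>
    using distr_Pair_couplings[of \<mu> "U \<eta>" V] U_meas[OF that] that
    by (simp add: \<beta>_def \<nu> meas prob_space_axioms R2_def U_def)
  have cost: "mk_cost \<iota> (\<beta> \<eta>) = ennreal (Q \<eta>)" if "\<eta> \<in> R2 \<mu> \<iota>" for \<eta>
    unfolding \<beta>_def Q_def
  proof (rule mk_cost_distr[OF linear_incl continuous_incl inj_incl])
    show "(\<lambda>x. \<eta> x - v x) \<in> L2 \<mu>" using that assms(2) by (auto simp: R2_def intro: L2_diff)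
    show "U \<eta> x - V x = \<iota> (\<eta> x - v x)" for x by (simp add: U_def assms(3) incl_diff)
  qed (simp_all add: meas U_meas[OF that])
  have M_le: "M_functional \<mu> v \<eta> \<le> M_functional \<mu> v \<zeta> \<longleftrightarrow> Q \<eta> \<le> Q \<zeta>"
    if "\<eta> \<in> R2 \<mu> \<iota>" "\<zeta> \<in> R2 \<mu> \<iota>" for \<eta> \<zeta>
  proof -
    have "\<eta> \<in> L2 \<mu>" "\<zeta> \<in> L2 \<mu>" using that by (auto simp: R2_def)
    then show ?thesis unfolding Q_def using assms(2) by (simp only: M_functional_eq) simp
  qed

  \<comment> \<open>The field is determined only up to null sets, so an arbitrary measurable version
    is treated.\<close>
  have main: "\<alpha> \<in> R2 \<mu> \<iota> \<and>
       (\<forall>\<eta> \<in> R2 \<mu> \<iota>. M_functional \<mu> v \<alpha> \<le> M_functional \<mu> v \<eta>) \<and>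
       (\<forall>\<eta> \<in> R2 \<mu> \<iota>. (\<forall>\<zeta> \<in> R2 \<mu> \<iota>. M_functional \<mu> v \<eta> \<le> M_functional \<mu> v \<zeta>) \<longrightarrow>
          (AE x in \<mu>. \<eta> x = \<alpha> x))"
    if \<alpha>: "\<alpha> \<in> borel_measurable \<mu>" "AE x in \<mu>. s x = x + \<iota> (\<alpha> x)" for \<alpha>
  proof (intro conjI ballI impI)
    have [measurable]: "\<alpha> \<in> borel_measurable borel" using \<alpha>(1) by (simp add: meas)
    have "AE x in \<mu>. \<alpha>0 x = \<alpha> x"
      using s_eq \<alpha>(2) by eventually_elim (simp add: inj_eq[OF inj_incl])
    then have "\<alpha> \<in> L2 \<mu>" using \<alpha>0_L2 \<alpha>(1) L2_cong_AE by blast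
    moreover have "distr \<mu> borel (\<lambda>x. x + \<iota> (\<alpha> x)) = distr \<mu> borel s"
      using \<alpha>(2) by (intro distr_cong_AE) (auto simp: meas elim: eventually_mono)
    ultimately show R: "\<alpha> \<in> R2 \<mu> \<iota>" by (simp add: R2_def s_rot)
    \<comment> \<open>The pair \<open>(s, V)\<close> agrees almost surely with
      \<open>(s, T \<circ> s)\<close>, and \<open>s\<close> has law \<open>\<mu>\<close>; hence
      \<open>\<beta> \<alpha>\<close> is the optimal coupling.\<close>
    have "\<beta> \<alpha> = distr \<mu> borel (\<lambda>x. (s x, T (s x)))"
      unfolding \<beta>_def
    proof (rule distr_cong_AE)
      show "AE x in \<mu>. (U \<alpha> x, V x) = (s x, T (s x))"
        using \<alpha>(2) V_eq by eventually_elim (simp add: U_def)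
    qed (use U_meas[OF R] in \<open>auto simp: meas\<close>)
    also have "\<dots> = distr (distr \<mu> borel s) borel (\<lambda>x. (x, T x))"
      by (subst distr_distr) (auto simp: meas comp_def)
    finally have "\<beta> \<alpha> \<in> mk_solutions \<iota> \<mu> \<nu>" using sol s_rot by simp
    then have opt: "ennreal (Q \<alpha>) = dH_sq \<iota> \<mu> \<nu>"
      using cost[OF R] by (simp add: mk_solutions_def)
    \<comment> \<open>Since \<open>ennreal\<close> truncates negative reals to 0, this sign is what
      allows costs to be compared as reals.\<close>
    have Q_nonneg: "0 \<le> Q \<eta>" for \<eta> by (simp add: Q_def)
    have dH_le: "dH_sq \<iota> \<mu> \<nu> \<le> ennreal (Q \<eta>)" if "\<eta> \<in> R2 \<mu> \<iota>" for \<eta>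
      unfolding dH_sq_def cost[OF that, symmetric] by (rule INF_lower[OF coupling[OF that]])
    show "M_functional \<mu> v \<alpha> \<le> M_functional \<mu> v \<eta>" if "\<eta> \<in> R2 \<mu> \<iota>" for \<eta>
      using dH_le[OF that] Q_nonneg[of \<eta>] by (simp add: M_le[OF R that] flip: opt)
    fix \<eta> assume \<eta>: "\<eta> \<in> R2 \<mu> \<iota>"
      and min: "\<forall>\<zeta> \<in> R2 \<mu> \<iota>. M_functional \<mu> v \<eta> \<le> M_functional \<mu> v \<zeta>"
    \<comment> \<open>A minimizer costs no more than \<open>\<alpha>\<close>, so its coupling is
      also optimal and coincides with the one on the graph of \<open>T\<close>.\<close>
    have "Q \<eta> \<le> Q \<alpha>" using min R \<eta> M_le by blast
    then have "ennreal (Q \<eta>) = dH_sq \<iota> \<mu> \<nu>"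
      using dH_le[OF \<eta>] opt by (metis antisym ennreal_leI)
    then have "\<beta> \<eta> = distr \<mu> borel (\<lambda>x. (x, T x))"
      using sol coupling[OF \<eta>] cost[OF \<eta>] by (auto simp: mk_solutions_def)
    then have "AE x in \<mu>. V x = T (U \<eta> x)"
      unfolding \<beta>_def using U_meas[OF \<eta>] by (intro AE_eq_graph[where N = \<mu>]) (auto simp: meas)
    \<comment> \<open>The identity \<open>Tinv (T x) = x\<close> holds only
      \<open>\<mu>\<close>-almost surely; it can be evaluated at \<open>U \<eta> x\<close> because
      \<open>U \<eta>\<close> preserves \<open>\<mu>\<close>. Then
      \<open>s x = Tinv (V x) = U \<eta> x\<close>, and injectivity of \<open>\<iota>\<close>
      identifies the fields.\<close>
    moreover have "distr \<mu> borel (U \<eta>) = \<mu>" using \<eta> by (simp add: R2_def U_def)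
    then have "AE x in distr \<mu> borel (U \<eta>). Tinv (T x) = x"
      using trans(2) by (metis transport_inverse_def)
    then have "AE x in \<mu>. Tinv (T (U \<eta> x)) = U \<eta> x"
      using U_meas[OF \<eta>] by (auto dest!: AE_distrD[rotated] simp: meas)
    ultimately show "AE x in \<mu>. \<eta> x = \<alpha> x"
      using \<alpha>(2) by eventually_elim (simp add: assms(10) U_def inj_eq[OF inj_incl])
  qed
  have "\<alpha>0 \<in> borel_measurable \<mu>" by (simp add: meas)
  then show ?thesis using s_eq main by blast
qed

end
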